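(* Let $\mathcal{H}$ be a separable complex Hilbert space. Let $E=(E_{n,k})_{n,k\ge1}$ be an invertible infinite complex matrix and let $m=\{m_k\}_{k=1}^\infty$ be a positive (resp. negative) and semi-normalized sequence such that $m_nE_{n,k}=E_{n,k}m_k$ for all $n,k\in\mathbb{N}$. Suppose that $\Psi=\{\psi_k\}_{k=1}^\infty$ is an $E$-frame for $\mathcal{H}$. Then $\{\sqrt{m_k}\,\psi_k\}_{k=1}^\infty$ (resp. $\{\sqrt{|m_k|}\,\psi_k\}_{k=1}^\infty$) is an $E$-frame for $\mathcal{H}$ and $$M^{E}_{m,\Psi,\Psi}=S_{E\{\sqrt{m_k}\psi_k\}}\qquad\left(\text{resp. } M^{E}_{m,\Psi,\Psi}=-S_{E\{\sqrt{|m_k|}\psi_k\}}\right),$$ and therefore $M^{E}_{m,\Psi,\Psi}$ is invertible on $\mathcal{H}$.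
   Context: An infinite complex matrix $E$ is invertible if there is an infinite complex matrix $E^{-1}$ with $EE^{-1}=E^{-1}E=I$ (all entrywise sums converging). For a sequence $\{\psi_k\}$ in $\mathcal{H}$ write $E\{\psi_k\}_{k=1}^\infty=\{\sum_{k=1}^\infty E_{n,k}\psi_k\}_{n=1}^\infty$, with $n$-th term $(E\{\psi_k\}_{k=1}^\infty)_n$. $\{\psi_k\}$ is an $E$-frame for $\mathcal{H}$ if all these series converge in $\mathcal{H}$ and there are $0<A\le B<\infty$ with $A\|f\|^2\le\sum_{n=1}^\infty|\langle f,(E\{\psi_k\}_{k=1}^\infty)_n\rangle|^2\le B\|f\|^2$ for all $f\in\mathcal{H}$. (It is not required that $E$ define a mapping on $\bigoplus_{n=1}^\infty\mathcal{H}$.) The $E$-frame operator of an $E$-frame $\{\psi_k\}$ is $S_{E\{\psi_k\}}f=\sum_{n=1}^\infty\langle f,(E\{\psi_k\}_{k=1}^\infty)_n\rangle(E\{\psi_k\}_{k=1}^\infty)_n$. The $E$-multiplier of $\Psi=\{\psi_k\}$ and $\Phi=\{\phi_k\}$ with symbol $m$ is $M^{E}_{m,\Psi,\Phi}f=\sum_{n=1}^\infty m_n\langle f,(E\{\phi_k\}_{k=1}^\infty)_n\rangle(E\{\psi_k\}_{k=1}^\infty)_n$. A scalar sequence $m$ is semi-normalized if $0<\inf_n|m_n|\le\sup_n|m_n|<\infty$; positive (negative) means $m_k>0$ ($m_k<0$) for all $k$. *)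

theory Defs
  imports "HOL-Analysis.Analysis"
begin

text \<open>
  Complex Hilbert spaces. The norm, the metric, completeness and the real scalar multiplication
  are those of the class of real Banach spaces; the inner product is linear in its first argument
  and induces the norm. The trivial space is included.
\<close>

class complex_hilbert = banach +
  fixes scaleC :: "complex \<Rightarrow> 'a \<Rightarrow> 'a" (infixr \<open>*\<^sub>C\<close> 75)
    and cinner :: "'a \<Rightarrow> 'a \<Rightarrow> complex"
  assumes scaleC_of_real: "complex_of_real r *\<^sub>C x = r *\<^sub>R x"
    and scaleC_add_right: "a *\<^sub>C (x + y) = a *\<^sub>C x + a *\<^sub>C y"
    and scaleC_add_left: "(a + b) *\<^sub>C x = a *\<^sub>C x + b *\<^sub>C x"
    and scaleC_scaleC: "a *\<^sub>C (b *\<^sub>C x) = (a * b) *\<^sub>C x"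
    and cinner_commute: "cinner x y = cnj (cinner y x)"
    and cinner_add_left: "cinner (x + y) z = cinner x z + cinner y z"
    and cinner_scaleC_left: "cinner (a *\<^sub>C x) y = a * cinner x y"
    and cinner_self: "cinner x x = complex_of_real ((norm x)\<^sup>2)"

instantiation complex :: complex_hilbert
begin

definition scaleC_complex :: "complex \<Rightarrow> complex \<Rightarrow> complex"
  where "scaleC_complex a x = a * x"

definition cinner_complex :: "complex \<Rightarrow> complex \<Rightarrow> complex"
  where "cinner_complex x y = x * cnj y"

instance
proof
  fix x :: complex
  show "cinner x x = complex_of_real ((norm x)\<^sup>2)"
    unfolding cinner_complex_def by (rule complex_norm_square[symmetric])
qed (simp_all add: scaleC_complex_def cinner_complex_def scaleR_conv_of_real algebra_simps)

end

text \<open>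
  Sequences and matrices are indexed by \<open>nat\<close> from 0 instead of from 1. All infinite sums are
  ordinary (possibly conditionally convergent) series.
\<close>

definition infinite_matrix_inverse ::
    "(nat \<Rightarrow> nat \<Rightarrow> complex) \<Rightarrow> (nat \<Rightarrow> nat \<Rightarrow> complex) \<Rightarrow> bool"
  where "infinite_matrix_inverse E F \<longleftrightarrow>
    (\<forall>n l. (\<lambda>k. E n k * F k l) sums (if n = l then 1 else 0)) \<and>
    (\<forall>n l. (\<lambda>k. F n k * E k l) sums (if n = l then 1 else 0))"

definition infinite_matrix_invertible :: "(nat \<Rightarrow> nat \<Rightarrow> complex) \<Rightarrow> bool"
  where "infinite_matrix_invertible E \<longleftrightarrow> (\<exists>F. infinite_matrix_inverse E F)"

definition matrix_seq ::
    "(nat \<Rightarrow> nat \<Rightarrow> complex) \<Rightarrow> (nat \<Rightarrow> 'a::complex_hilbert) \<Rightarrow> nat \<Rightarrow> 'a"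
  where "matrix_seq E \<psi> n = (\<Sum>k. E n k *\<^sub>C \<psi> k)"

definition matrix_seq_defined ::
    "(nat \<Rightarrow> nat \<Rightarrow> complex) \<Rightarrow> (nat \<Rightarrow> 'a::complex_hilbert) \<Rightarrow> bool"
  where "matrix_seq_defined E \<psi> \<longleftrightarrow> (\<forall>n. summable (\<lambda>k. E n k *\<^sub>C \<psi> k))"

text \<open>Summability is required explicitly because \<open>suminf\<close> is unspecified on divergent series.\<close>

definition E_frame ::
    "(nat \<Rightarrow> nat \<Rightarrow> complex) \<Rightarrow> (nat \<Rightarrow> 'a::complex_hilbert) \<Rightarrow> bool"
  where "E_frame E \<psi> \<longleftrightarrow> matrix_seq_defined E \<psi> \<and>
    (\<exists>A B :: real. 0 < A \<and> A \<le> B \<and>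
      (\<forall>f. summable (\<lambda>n. (cmod (cinner f (matrix_seq E \<psi> n)))\<^sup>2) \<and>
        A * (norm f)\<^sup>2 \<le> (\<Sum>n. (cmod (cinner f (matrix_seq E \<psi> n)))\<^sup>2) \<and>
        (\<Sum>n. (cmod (cinner f (matrix_seq E \<psi> n)))\<^sup>2) \<le> B * (norm f)\<^sup>2))"

definition E_frame_operator ::
    "(nat \<Rightarrow> nat \<Rightarrow> complex) \<Rightarrow> (nat \<Rightarrow> 'a::complex_hilbert) \<Rightarrow> 'a \<Rightarrow> 'a"
  where "E_frame_operator E \<psi> f =
    (\<Sum>n. cinner f (matrix_seq E \<psi> n) *\<^sub>C matrix_seq E \<psi> n)"

definition E_frame_operator_defined ::
    "(nat \<Rightarrow> nat \<Rightarrow> complex) \<Rightarrow> (nat \<Rightarrow> 'a::complex_hilbert) \<Rightarrow> bool"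
  where "E_frame_operator_defined E \<psi> \<longleftrightarrow> matrix_seq_defined E \<psi> \<and>
    (\<forall>f. summable (\<lambda>n. cinner f (matrix_seq E \<psi> n) *\<^sub>C matrix_seq E \<psi> n))"

definition E_multiplier ::
    "(nat \<Rightarrow> nat \<Rightarrow> complex) \<Rightarrow> (nat \<Rightarrow> complex) \<Rightarrow> (nat \<Rightarrow> 'a::complex_hilbert) \<Rightarrow>
      (nat \<Rightarrow> 'a) \<Rightarrow> 'a \<Rightarrow> 'a"
  where "E_multiplier E m \<psi> \<phi> f =
    (\<Sum>n. m n *\<^sub>C cinner f (matrix_seq E \<phi> n) *\<^sub>C matrix_seq E \<psi> n)"

definition E_multiplier_defined ::
    "(nat \<Rightarrow> nat \<Rightarrow> complex) \<Rightarrow> (nat \<Rightarrow> complex) \<Rightarrow> (nat \<Rightarrow> 'a::complex_hilbert) \<Rightarrow>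
      (nat \<Rightarrow> 'a) \<Rightarrow> bool"
  where "E_multiplier_defined E m \<psi> \<phi> \<longleftrightarrow>
    matrix_seq_defined E \<psi> \<and> matrix_seq_defined E \<phi> \<and>
    (\<forall>f. summable (\<lambda>n. m n *\<^sub>C cinner f (matrix_seq E \<phi> n) *\<^sub>C matrix_seq E \<psi> n))"

definition semi_normalized :: "(nat \<Rightarrow> complex) \<Rightarrow> bool"
  where "semi_normalized m \<longleftrightarrow>
    0 < (INF n. cmod (m n)) \<and> bdd_above (range (\<lambda>n. cmod (m n)))"

definition bounded_clinear :: "('a::complex_hilbert \<Rightarrow> 'a) \<Rightarrow> bool"
  where "bounded_clinear T \<longleftrightarrow> bounded_linear T \<and> (\<forall>c x. T (c *\<^sub>C x) = c *\<^sub>C T x)"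

definition invertible_operator :: "('a::complex_hilbert \<Rightarrow> 'a) \<Rightarrow> bool"
  where "invertible_operator T \<longleftrightarrow> bounded_clinear T \<and>
    (\<exists>R. bounded_clinear R \<and> T \<circ> R = id \<and> R \<circ> T = id)"

end

theory Submission
  imports Defs
begin

text \<open>
  The commutation hypothesis says that \<open>E n k \<noteq> 0\<close> forces \<open>m n = m k\<close>. Hence \<open>E\<close> also commutes
  with the diagonal matrix of the weights \<open>sqrt \<bar>m k\<bar>\<close>, and the \<open>n\<close>-th term of \<open>E\<close> applied to the
  weighted sequence is \<open>sqrt \<bar>m n\<bar>\<close> times the \<open>n\<close>-th term \<open>g n\<close> of \<open>E\<close> applied to \<open>\<psi>\<close>
  (\<open>matrix_seq_weighted\<close>). Write \<open>h n\<close> for the product. Since \<open>m\<close> is semi-normalized, \<open>h\<close> inherits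
  frame bounds from \<open>g\<close> (\<open>frame_bounds_weighted\<close>), and since the two square roots multiply to
  \<open>\<bar>m n\<bar>\<close>, the multiplier with symbol \<open>m\<close> agrees term by term, up to the common sign of \<open>m\<close>, with
  the frame operator of \<open>h\<close>.

  What remains is the classical fact that the frame operator \<open>S f = (\<Sum>n. \<langle>f, h n\<rangle> h n)\<close> of a frame
  with bounds \<open>A\<close> and \<open>B\<close> converges and is invertible. Convergence follows from the estimate
  \<open>\<parallel>\<Sum>n. c n h n\<parallel>\<^sup>2 \<le> B (\<Sum>n. \<bar>c n\<bar>\<^sup>2)\<close>, which is dual to the upper frame inequality
  (\<open>frame_bounds_synthesis\<close>). Applied to \<open>c n = \<langle>f, h n\<rangle>\<close> it yields
  \<open>\<parallel>S f\<parallel>\<^sup>2 \<le> B \<langle>S f, f\<rangle>\<close>, and therefore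
  \<open>\<parallel>f - S f / B\<parallel>\<^sup>2 \<le> \<parallel>f\<parallel>\<^sup>2 - \<langle>S f, f\<rangle> / B \<le> (1 - A / B) \<parallel>f\<parallel>\<^sup>2\<close>.
  So \<open>f \<mapsto> f - S f / B\<close> is a contraction, and the fixed point theorem solves \<open>S f = y\<close> for every
  \<open>y\<close> (\<open>frame_op_surj\<close>); the lower frame bound makes the inverse bounded.
\<close>

section \<open>Inner products and scalar multiplication\<close>

lemma cinner_add_right: "cinner x (y + z) = cinner x y + cinner x z"
  for x :: "'a::complex_hilbert"
  by (metis cinner_add_left cinner_commute complex_cnj_add)

lemma cinner_scaleC_right: "cinner x (a *\<^sub>C y) = cnj a * cinner x y"
  for x :: "'a::complex_hilbert"
  by (metis cinner_scaleC_left cinner_commute complex_cnj_mult)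

lemma scaleR_eq_scaleC: "r *\<^sub>R x = complex_of_real r *\<^sub>C x"
  for x :: "'a::complex_hilbert"
  by (simp add: scaleC_of_real)

lemma cinner_scaleR_left: "cinner (r *\<^sub>R x) y = complex_of_real r * cinner x y"
  for x :: "'a::complex_hilbert"
  by (simp add: scaleR_eq_scaleC cinner_scaleC_left)

lemma cinner_scaleR_right: "cinner x (r *\<^sub>R y) = complex_of_real r * cinner x y"
  for x :: "'a::complex_hilbert"
  by (simp add: scaleR_eq_scaleC cinner_scaleC_right)

lemma cinner_sum_left: "cinner (sum f N) y = (\<Sum>n\<in>N. cinner (f n) y)"
  for y :: "'a::complex_hilbert"
proof -
  have "cinner (0::'a) y = 0"
    using cinner_add_left[of 0 0 y] by simp
  then show ?thesis
    by (induction N rule: infinite_finite_induct) (simp_all add: cinner_add_left)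
qed

lemma cmod_cinner_commute: "cmod (cinner x y) = cmod (cinner y x)"
  for x :: "'a::complex_hilbert"
  by (metis cinner_commute complex_mod_cnj)

lemma norm_add_square: "(norm (x + y))\<^sup>2 = (norm x)\<^sup>2 + 2 * Re (cinner x y) + (norm y)\<^sup>2"
  for x :: "'a::complex_hilbert"
proof -
  have "cinner (x + y) (x + y) = cinner x x + cinner x y + cnj (cinner x y) + cinner y y"
    using cinner_commute[of y x] by (simp add: cinner_add_left cinner_add_right)
  then have "Re (cinner (x + y) (x + y)) = Re (cinner x x) + 2 * Re (cinner x y) + Re (cinner y y)"
    by simp
  then show ?thesis
    by (simp add: cinner_self)
qed

lemma norm_scaleC: "norm (a *\<^sub>C x) = cmod a * norm x"
  for x :: "'a::complex_hilbert"
proof -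
  have "cinner (a *\<^sub>C x) (a *\<^sub>C x) = a * cnj a * cinner x x"
    by (simp add: cinner_scaleC_left cinner_scaleC_right)
  then have "complex_of_real ((norm (a *\<^sub>C x))\<^sup>2) = complex_of_real ((cmod a * norm x)\<^sup>2)"
    by (simp only: cinner_self complex_norm_square[symmetric] power_mult_distrib of_real_mult
        of_real_power)
  then have "(norm (a *\<^sub>C x))\<^sup>2 = (cmod a * norm x)\<^sup>2"
    using of_real_eq_iff by blast
  then show ?thesis
    by simp
qed

lemma bounded_linear_scaleC: "bounded_linear (\<lambda>x::'a::complex_hilbert. a *\<^sub>C x)"
proof (rule bounded_linear_intro[where K = "cmod a"])
  show "a *\<^sub>C (r *\<^sub>R x) = r *\<^sub>R (a *\<^sub>C x)" for r and x :: 'a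
    by (simp add: scaleR_eq_scaleC scaleC_scaleC mult.commute)
qed (simp_all add: scaleC_add_right norm_scaleC mult.commute)

text \<open>
  The square of \<open>\<parallel>y\<parallel>\<^sup>2 x - \<langle>x, y\<rangle> y\<close>, a multiple of the component of \<open>x\<close> orthogonal to \<open>y\<close>,
  is nonnegative.
\<close>
lemma cauchy_schwarz: "cmod (cinner x y) \<le> norm x * norm y"
  for x :: "'a::complex_hilbert"
proof (cases "y = 0")
  case True
  have "cinner x (0 + 0) = cinner x 0 + cinner x 0"
    by (rule cinner_add_right)
  with True show ?thesis
    by simp
next
  case False
  define c where "c = cinner x y"
  define t where "t = (norm y)\<^sup>2"
  have t: "t > 0"
    using False by (simp add: t_def)
  have "cinner (t *\<^sub>R x) ((- c) *\<^sub>C y) = complex_of_real (- t) * (c * cnj c)"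
    by (simp add: cinner_scaleR_left cinner_scaleC_right mult_ac flip: c_def)
  then have re: "Re (cinner (t *\<^sub>R x) ((- c) *\<^sub>C y)) = - t * (cmod c)\<^sup>2"
    unfolding complex_norm_square[symmetric] of_real_mult[symmetric] Re_complex_of_real
    by (metis Re_complex_of_real)
  have "0 \<le> (norm (t *\<^sub>R x + (- c) *\<^sub>C y))\<^sup>2"
    by simp
  also have "\<dots> = t\<^sup>2 * (norm x)\<^sup>2 - 2 * t * (cmod c)\<^sup>2 + (cmod c)\<^sup>2 * t"
    unfolding norm_add_square re by (simp add: norm_scaleC power_mult_distrib t_def)
  finally have "t * (cmod c)\<^sup>2 \<le> t * (t * (norm x)\<^sup>2)"
    by (simp add: power2_eq_square algebra_simps)
  with t have "(cmod c)\<^sup>2 \<le> (norm x * norm y)\<^sup>2"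
    by (simp add: t_def power_mult_distrib mult.commute)
  then show ?thesis
    unfolding c_def by (rule power2_le_imp_le) simp
qed

lemma bounded_linear_cinner_left: "bounded_linear (\<lambda>x::'a::complex_hilbert. cinner x y)"
proof (rule bounded_linear_intro[where K = "norm y"])
  show "cinner (r *\<^sub>R x) y = r *\<^sub>R cinner x y" for r and x :: 'a
    by (simp add: cinner_scaleR_left scaleR_conv_of_real)
qed (simp_all add: cinner_add_left cauchy_schwarz)

section \<open>The frame operator of a frame\<close>

definition frame_bounds :: "real \<Rightarrow> real \<Rightarrow> (nat \<Rightarrow> 'a::complex_hilbert) \<Rightarrow> bool"
  where "frame_bounds A B h \<longleftrightarrow> 0 < A \<and> A \<le> B \<and>
    (\<forall>f. summable (\<lambda>n. (cmod (cinner f (h n)))\<^sup>2) \<and>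
      A * (norm f)\<^sup>2 \<le> (\<Sum>n. (cmod (cinner f (h n)))\<^sup>2) \<and>
      (\<Sum>n. (cmod (cinner f (h n)))\<^sup>2) \<le> B * (norm f)\<^sup>2)"

lemma E_frame_iff: "E_frame E \<psi> \<longleftrightarrow>
    matrix_seq_defined E \<psi> \<and> (\<exists>A B. frame_bounds A B (matrix_seq E \<psi>))"
  by (auto simp: E_frame_def frame_bounds_def)

lemma frame_bounds_summable:
  "frame_bounds A B h \<Longrightarrow> summable (\<lambda>n. (cmod (cinner f (h n)))\<^sup>2)"
  and frame_bounds_lower:
  "frame_bounds A B h \<Longrightarrow> A * (norm f)\<^sup>2 \<le> (\<Sum>n. (cmod (cinner f (h n)))\<^sup>2)"
  and frame_bounds_upper:
  "frame_bounds A B h \<Longrightarrow> (\<Sum>n. (cmod (cinner f (h n)))\<^sup>2) \<le> B * (norm f)\<^sup>2"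
  and frame_bounds_pos: "frame_bounds A B h \<Longrightarrow> 0 < A" "frame_bounds A B h \<Longrightarrow> 0 < B"
    "frame_bounds A B h \<Longrightarrow> A \<le> B"
  by (auto simp: frame_bounds_def)

text \<open>
  Pairing \<open>v = (\<Sum>n\<in>N. c n h n)\<close> with itself gives \<open>\<parallel>v\<parallel>\<^sup>2 = (\<Sum>n\<in>N. c n \<langle>h n, v\<rangle>)\<close>. By Cauchy-Schwarz
  for sums and the upper frame inequality at \<open>v\<close>, this is at most \<open>sqrt (\<Sum>\<bar>c n\<bar>\<^sup>2) sqrt B \<parallel>v\<parallel>\<close>.
\<close>
lemma frame_bounds_finite_synthesis:
  fixes h :: "nat \<Rightarrow> 'a::complex_hilbert"
  assumes h: "frame_bounds A B h" and "finite N"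
  shows "(norm (\<Sum>n\<in>N. c n *\<^sub>C h n))\<^sup>2 \<le> B * (\<Sum>n\<in>N. (cmod (c n))\<^sup>2)"
proof -
  define v where "v = (\<Sum>n\<in>N. c n *\<^sub>C h n)"
  have "complex_of_real ((norm v)\<^sup>2) = (\<Sum>n\<in>N. c n * cinner (h n) v)"
    unfolding cinner_self[symmetric]
    by (subst (1) v_def) (simp add: cinner_sum_left cinner_scaleC_left)
  then have "(norm v)\<^sup>2 = cmod (\<Sum>n\<in>N. c n * cinner (h n) v)"
    by (metis abs_power2 norm_of_real real_norm_def)
  also have "\<dots> \<le> (\<Sum>n\<in>N. cmod (c n) * cmod (cinner v (h n)))"
    by (rule order_trans[OF norm_sum]) (simp add: norm_mult cmod_cinner_commute[of v])
  finally have "((norm v)\<^sup>2)\<^sup>2 \<le> (\<Sum>n\<in>N. cmod (c n) * cmod (cinner v (h n)))\<^sup>2"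
    by (rule power_mono) simp
  also have "\<dots> \<le> (\<Sum>n\<in>N. (cmod (c n))\<^sup>2) * (\<Sum>n\<in>N. (cmod (cinner v (h n)))\<^sup>2)"
    by (rule Cauchy_Schwarz_ineq_sum)
  also have "\<dots> \<le> (\<Sum>n\<in>N. (cmod (c n))\<^sup>2) * (B * (norm v)\<^sup>2)"
  proof (rule mult_left_mono)
    have "(\<Sum>n\<in>N. (cmod (cinner v (h n)))\<^sup>2) \<le> (\<Sum>n. (cmod (cinner v (h n)))\<^sup>2)"
      using \<open>finite N\<close> by (intro sum_le_suminf frame_bounds_summable[OF h]) auto
    then show "(\<Sum>n\<in>N. (cmod (cinner v (h n)))\<^sup>2) \<le> B * (norm v)\<^sup>2"
      using frame_bounds_upper[OF h, of v] by simp
  qed (simp add: sum_nonneg)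
  finally have "(norm v)\<^sup>2 * (norm v)\<^sup>2 \<le> (B * (\<Sum>n\<in>N. (cmod (c n))\<^sup>2)) * (norm v)\<^sup>2"
    by (simp add: power2_eq_square mult_ac)
  moreover have "0 \<le> B * (\<Sum>n\<in>N. (cmod (c n))\<^sup>2)"
    using frame_bounds_pos(2)[OF h] by (simp add: sum_nonneg)
  ultimately show ?thesis
    unfolding v_def[symmetric]
    by (cases "v = 0") (simp, rule mult_right_le_imp_le[of _ "(norm v)\<^sup>2"],
        simp_all only: zero_less_power zero_less_norm_iff not_False_eq_True)
qed

lemma frame_bounds_synthesis_summable:
  fixes h :: "nat \<Rightarrow> 'a::complex_hilbert"
  assumes h: "frame_bounds A B h" and c: "summable (\<lambda>n. (cmod (c n))\<^sup>2)"
  shows "summable (\<lambda>n. c n *\<^sub>C h n)"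
  unfolding summable_Cauchy
proof (intro allI impI)
  fix e :: real
  assume "e > 0"
  have B: "B > 0"
    using frame_bounds_pos(2)[OF h] .
  with \<open>e > 0\<close> have "e\<^sup>2 / B > 0"
    by simp
  then obtain N where N: "\<And>i j. i \<ge> N \<Longrightarrow> norm (\<Sum>n=i..<j. (cmod (c n))\<^sup>2) < e\<^sup>2 / B"
    using c unfolding summable_Cauchy by meson
  have "norm (\<Sum>n=i..<j. c n *\<^sub>C h n) < e" if "i \<ge> N" for i j
  proof -
    have "(norm (\<Sum>n=i..<j. c n *\<^sub>C h n))\<^sup>2 \<le> B * (\<Sum>n=i..<j. (cmod (c n))\<^sup>2)"
      by (rule frame_bounds_finite_synthesis[OF h]) simp
    also have "\<dots> < e\<^sup>2"
      using N[OF that, of j] B by (simp add: field_simps sum_nonneg)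
    finally show ?thesis
      using \<open>e > 0\<close> by (simp add: power_less_imp_less_base[of _ 2])
  qed
  then show "\<exists>N. \<forall>i\<ge>N. \<forall>j. norm (\<Sum>n=i..<j. c n *\<^sub>C h n) < e"
    by blast
qed

lemma frame_bounds_synthesis:
  fixes h :: "nat \<Rightarrow> 'a::complex_hilbert"
  assumes h: "frame_bounds A B h" and c: "summable (\<lambda>n. (cmod (c n))\<^sup>2)"
  shows "(norm (\<Sum>n. c n *\<^sub>C h n))\<^sup>2 \<le> B * (\<Sum>n. (cmod (c n))\<^sup>2)"
proof (rule LIMSEQ_le)
  show "(\<lambda>k. (norm (\<Sum>n<k. c n *\<^sub>C h n))\<^sup>2) \<longlonglongrightarrow> (norm (\<Sum>n. c n *\<^sub>C h n))\<^sup>2"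
    by (intro tendsto_intros summable_LIMSEQ frame_bounds_synthesis_summable[OF h c])
  show "(\<lambda>k. B * (\<Sum>n<k. (cmod (c n))\<^sup>2)) \<longlonglongrightarrow> B * (\<Sum>n. (cmod (c n))\<^sup>2)"
    by (intro tendsto_intros summable_LIMSEQ c)
  show "\<exists>N. \<forall>k\<ge>N. (norm (\<Sum>n<k. c n *\<^sub>C h n))\<^sup>2 \<le> B * (\<Sum>n<k. (cmod (c n))\<^sup>2)"
    using frame_bounds_finite_synthesis[OF h] by blast
qed

definition frame_op :: "(nat \<Rightarrow> 'a::complex_hilbert) \<Rightarrow> 'a \<Rightarrow> 'a"
  where "frame_op h f = (\<Sum>n. cinner f (h n) *\<^sub>C h n)"

lemma frame_op_summable:
  "frame_bounds A B h \<Longrightarrow> summable (\<lambda>n. cinner f (h n) *\<^sub>C h n)"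
  by (rule frame_bounds_synthesis_summable[OF _ frame_bounds_summable])

text \<open>
  This turns the frame inequalities into the operator bounds
  \<open>A \<parallel>f\<parallel>\<^sup>2 \<le> \<langle>S f, f\<rangle> \<le> B \<parallel>f\<parallel>\<^sup>2\<close> for \<open>S = frame_op h\<close>.
\<close>
lemma cinner_frame_op:
  fixes h :: "nat \<Rightarrow> 'a::complex_hilbert"
  assumes h: "frame_bounds A B h"
  shows "cinner (frame_op h f) f = complex_of_real (\<Sum>n. (cmod (cinner f (h n)))\<^sup>2)"
proof -
  have "cinner (frame_op h f) f = (\<Sum>n. cinner (cinner f (h n) *\<^sub>C h n) f)"
    unfolding frame_op_def
    by (rule bounded_linear.suminf[OF bounded_linear_cinner_left frame_op_summable[OF h]])
  also have "\<dots> = (\<Sum>n. complex_of_real ((cmod (cinner f (h n)))\<^sup>2))"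
  proof (rule suminf_cong)
    fix n
    show "cinner (cinner f (h n) *\<^sub>C h n) f = complex_of_real ((cmod (cinner f (h n)))\<^sup>2)"
      using cinner_commute[of "h n" f] by (simp add: cinner_scaleC_left complex_norm_square
          flip: of_real_power)
  qed
  also have "\<dots> = complex_of_real (\<Sum>n. (cmod (cinner f (h n)))\<^sup>2)"
    by (rule suminf_of_real[OF frame_bounds_summable[OF h], symmetric])
  finally show ?thesis .
qed

lemma frame_op_lower:
  fixes h :: "nat \<Rightarrow> 'a::complex_hilbert"
  assumes h: "frame_bounds A B h"
  shows "A * norm f \<le> norm (frame_op h f)"
proof (cases "f = 0")
  case False
  have "A * (norm f)\<^sup>2 \<le> (\<Sum>n. (cmod (cinner f (h n)))\<^sup>2)"
    by (rule frame_bounds_lower[OF h])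
  also have "\<dots> \<le> cmod (cinner (frame_op h f) f)"
    unfolding cinner_frame_op[OF h] by simp
  also have "\<dots> \<le> norm (frame_op h f) * norm f"
    by (rule cauchy_schwarz)
  finally have "(A * norm f) * norm f \<le> norm (frame_op h f) * norm f"
    by (simp add: power2_eq_square)
  with False show ?thesis
    by simp
qed simp

lemma frame_op_add:
  fixes h :: "nat \<Rightarrow> 'a::complex_hilbert"
  assumes h: "frame_bounds A B h"
  shows "frame_op h (f + g) = frame_op h f + frame_op h g"
  unfolding frame_op_def
  by (simp add: cinner_add_left scaleC_add_left suminf_add[OF frame_op_summable[OF h]
        frame_op_summable[OF h]])

lemma frame_op_scaleC:
  fixes h :: "nat \<Rightarrow> 'a::complex_hilbert"
  assumes h: "frame_bounds A B h"
  shows "frame_op h (a *\<^sub>C f) = a *\<^sub>C frame_op h f"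
  unfolding frame_op_def
  by (simp add: cinner_scaleC_left scaleC_scaleC[symmetric]
      bounded_linear.suminf[OF bounded_linear_scaleC frame_op_summable[OF h]])

lemma bounded_clinear_frame_op:
  fixes h :: "nat \<Rightarrow> 'a::complex_hilbert"
  assumes h: "frame_bounds A B h"
  shows "bounded_clinear (frame_op h)"
proof -
  have "bounded_linear (frame_op h)"
  proof (rule bounded_linear_intro)
    fix f
    have B: "B > 0"
      using frame_bounds_pos(2)[OF h] .
    have "(norm (frame_op h f))\<^sup>2 \<le> B * (\<Sum>n. (cmod (cinner f (h n)))\<^sup>2)"
      unfolding frame_op_def by (rule frame_bounds_synthesis[OF h frame_bounds_summable[OF h]])
    also have "\<dots> \<le> B * (B * (norm f)\<^sup>2)"
      using frame_bounds_upper[OF h] B by (simp add: mult_left_mono)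
    also have "\<dots> = (norm f * B)\<^sup>2"
      by (simp add: power2_eq_square mult_ac)
    finally show "norm (frame_op h f) \<le> norm f * B"
      by (rule power2_le_imp_le) (use B in simp)
  qed (simp_all only: frame_op_add[OF h] frame_op_scaleC[OF h] scaleR_eq_scaleC)
  then show ?thesis
    by (simp add: bounded_clinear_def frame_op_scaleC[OF h])
qed

text \<open>
  Expanding the square gives \<open>\<parallel>f\<parallel>\<^sup>2 - 2 \<langle>S f, f\<rangle> / B + \<parallel>S f\<parallel>\<^sup>2 / B\<^sup>2\<close>. The synthesis estimate
  bounds the last term by \<open>\<langle>S f, f\<rangle> / B\<close>, so it cancels only half of the middle term, and the
  lower frame inequality bounds what is left.
\<close>
lemma frame_op_relaxation_contraction:
  fixes h :: "nat \<Rightarrow> 'a::complex_hilbert"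
  assumes h: "frame_bounds A B h"
  shows "norm (f - (1 / B) *\<^sub>R frame_op h f) \<le> sqrt (1 - A / B) * norm f"
proof -
  define s where "s = (\<Sum>n. (cmod (cinner f (h n)))\<^sup>2)"
  have B: "B > 0"
    using frame_bounds_pos(2)[OF h] .
  have "cinner f (frame_op h f) = complex_of_real s"
    using cinner_commute[of f "frame_op h f"] by (simp add: cinner_frame_op[OF h] s_def)
  then have "(norm (f + (- (1 / B)) *\<^sub>R frame_op h f))\<^sup>2
      = (norm f)\<^sup>2 - 2 * s / B + (norm (frame_op h f))\<^sup>2 / B\<^sup>2"
    unfolding norm_add_square cinner_scaleR_right by (simp add: power_divide power_mult_distrib)
  also have "\<dots> \<le> (norm f)\<^sup>2 - s / B"
  proof -
    have "(norm (frame_op h f))\<^sup>2 \<le> B * s"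
      unfolding frame_op_def s_def
      by (rule frame_bounds_synthesis[OF h frame_bounds_summable[OF h]])
    then have "(norm (frame_op h f))\<^sup>2 / B\<^sup>2 \<le> s / B"
      using B by (simp add: field_simps power2_eq_square)
    then show ?thesis
      by simp
  qed
  also have "\<dots> \<le> (1 - A / B) * (norm f)\<^sup>2"
    using frame_bounds_lower[OF h, of f] B by (simp add: s_def field_simps)
  also have "\<dots> = (sqrt (1 - A / B) * norm f)\<^sup>2"
    using B frame_bounds_pos(3)[OF h] by (simp add: power_mult_distrib)
  finally have "(norm (f - (1 / B) *\<^sub>R frame_op h f))\<^sup>2 \<le> (sqrt (1 - A / B) * norm f)\<^sup>2"
    by simp
  then show ?thesis
    by (rule power2_le_imp_le) (use B frame_bounds_pos(3)[OF h] in simp_all)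
qed

text \<open>
  A solution of \<open>S f = y\<close> is a fixed point of \<open>f \<mapsto> y / B + (f - S f / B)\<close>, which is a contraction
  by the preceding estimate.
\<close>
lemma frame_op_surj:
  fixes h :: "nat \<Rightarrow> 'a::complex_hilbert"
  assumes h: "frame_bounds A B h"
  shows "\<exists>f. frame_op h f = y"
proof -
  define G where "G f = (1 / B) *\<^sub>R y + (f - (1 / B) *\<^sub>R frame_op h f)" for f
  have lin: "bounded_linear (frame_op h)"
    using bounded_clinear_frame_op[OF h] by (simp add: bounded_clinear_def)
  have AB: "0 < A" "0 < B" "A \<le> B"
    using frame_bounds_pos[OF h] by auto
  have "dist (G f) (G g) \<le> sqrt (1 - A / B) * dist f g" for f g
  proof -
    have "G f - G g = (f - g) - (1 / B) *\<^sub>R frame_op h (f - g)"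
      by (simp add: G_def bounded_linear.linear[OF lin] linear_diff scaleR_diff_right)
    then show ?thesis
      using frame_op_relaxation_contraction[OF h, of "f - g"] by (simp add: dist_norm)
  qed
  moreover have "0 \<le> sqrt (1 - A / B)" "sqrt (1 - A / B) < 1"
    using AB by auto
  ultimately obtain f where "G f = f"
    using banach_fix_type[of "sqrt (1 - A / B)" G] by blast
  then have "(1 / B) *\<^sub>R y = (1 / B) *\<^sub>R frame_op h f"
    by (simp add: G_def)
  with AB show ?thesis
    by auto
qed

lemma invertible_frame_op:
  fixes h :: "nat \<Rightarrow> 'a::complex_hilbert"
  assumes h: "frame_bounds A B h"
  shows "invertible_operator (frame_op h)"
proof -
  let ?S = "frame_op h"
  have A: "A > 0"
    using frame_bounds_pos(1)[OF h] .
  have "linear ?S"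
    using bounded_clinear_frame_op[OF h] by (simp add: bounded_clinear_def bounded_linear.linear)
  have inj: "f = g" if "?S f = ?S g" for f g
  proof -
    have "A * norm (f - g) \<le> 0"
      using frame_op_lower[OF h, of "f - g"] that \<open>linear ?S\<close> by (simp add: linear_diff)
    with A show ?thesis
      by (simp add: mult_le_0_iff)
  qed
  obtain R where SR: "\<And>y. ?S (R y) = y"
    using frame_op_surj[OF h] by metis
  have RS: "R (?S f) = f" for f
    by (rule inj) (rule SR)
  have scale: "R (a *\<^sub>C y) = a *\<^sub>C R y" for a y
    by (rule inj) (simp add: SR frame_op_scaleC[OF h])
  have "bounded_linear R"
  proof (rule bounded_linear_intro)
    show "R (x + y) = R x + R y" for x y
      by (rule inj) (simp add: SR frame_op_add[OF h])
    show "norm (R y) \<le> norm y * (1 / A)" for y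
      using frame_op_lower[OF h, of "R y"] A by (simp add: SR field_simps)
  qed (simp only: scaleR_eq_scaleC scale)
  then have "bounded_clinear R"
    by (simp add: bounded_clinear_def scale)
  moreover have "?S \<circ> R = id" "R \<circ> ?S = id"
    by (auto simp: SR RS)
  ultimately show ?thesis
    unfolding invertible_operator_def using bounded_clinear_frame_op[OF h] by blast
qed

lemma invertible_operator_uminus:
  fixes T :: "'a::complex_hilbert \<Rightarrow> 'a"
  assumes "invertible_operator T"
  shows "invertible_operator (\<lambda>f. - T f)"
proof -
  obtain R where T: "bounded_clinear T" and R: "bounded_clinear R"
    and inv: "T \<circ> R = id" "R \<circ> T = id"
    using assms unfolding invertible_operator_def by blast
  have neg: "bounded_clinear (\<lambda>f. - Q f)" if "bounded_clinear Q" for Q :: "'a \<Rightarrow> 'a"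
    using that by (simp add: bounded_clinear_def bounded_linear_minus
        linear_neg[OF bounded_linear.linear[OF bounded_linear_scaleC]])
  have "linear T" "linear R"
    using T R by (simp_all add: bounded_clinear_def bounded_linear.linear)
  moreover have "T (R y) = y" "R (T y) = y" for y
    using inv by (simp_all add: fun_eq_iff)
  ultimately have "(\<lambda>f. - T f) \<circ> (\<lambda>f. - R f) = id" "(\<lambda>f. - R f) \<circ> (\<lambda>f. - T f) = id"
    by (auto simp: linear_neg)
  then show ?thesis
    unfolding invertible_operator_def using neg[OF T] neg[OF R] by blast
qed

section \<open>Weighted frames\<close>

lemma frame_bounds_weighted:
  fixes g :: "nat \<Rightarrow> 'a::complex_hilbert"
  assumes g: "frame_bounds A B g"
    and w: "\<And>n. a \<le> w n" "\<And>n. w n \<le> b" and a: "0 < a"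
  shows "frame_bounds (a * A) (b * B) (\<lambda>n. sqrt (w n) *\<^sub>R g n)"
proof -
  let ?s = "\<lambda>f n. (cmod (cinner f (g n)))\<^sup>2"
  have AB: "0 < A" "0 < B" "A \<le> B"
    using frame_bounds_pos[OF g] by auto
  have b: "a \<le> b"
    using w order_trans by blast
  have w0: "0 \<le> w n" for n
    using a w(1)[of n] by simp
  have term_eq: "(cmod (cinner f (sqrt (w n) *\<^sub>R g n)))\<^sup>2 = w n * ?s f n" for f n
    using w0[of n] by (simp add: cinner_scaleR_right norm_mult power_mult_distrib)
  have sg: "summable (?s f)" for f
    by (rule frame_bounds_summable[OF g])
  have sw: "summable (\<lambda>n. w n * ?s f n)" for f
    by (rule summable_comparison_test'[OF summable_mult[OF sg, of b f], of 0])
      (use w w0 in \<open>auto intro: mult_right_mono\<close>)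
  have "a * A * (norm f)\<^sup>2 \<le> (\<Sum>n. w n * ?s f n)" for f
  proof -
    have "a * (A * (norm f)\<^sup>2) \<le> a * (\<Sum>n. ?s f n)"
      using a by (intro mult_left_mono frame_bounds_lower[OF g]) simp
    also have "\<dots> \<le> (\<Sum>n. w n * ?s f n)"
      unfolding suminf_mult[OF sg, symmetric]
      by (intro suminf_le summable_mult sg sw mult_right_mono w) simp
    finally show ?thesis
      by (simp add: mult.assoc)
  qed
  moreover have "(\<Sum>n. w n * ?s f n) \<le> b * B * (norm f)\<^sup>2" for f
  proof -
    have "(\<Sum>n. w n * ?s f n) \<le> b * (\<Sum>n. ?s f n)"
      unfolding suminf_mult[OF sg, symmetric]
      by (intro suminf_le summable_mult sg sw mult_right_mono w) simp
    also have "\<dots> \<le> b * (B * (norm f)\<^sup>2)"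
      using a b by (intro mult_left_mono frame_bounds_upper[OF g]) simp
    finally show ?thesis
      by (simp add: mult.assoc)
  qed
  moreover have "0 < a * A" "a * A \<le> b * B"
    using a b AB by (auto intro: mult_mono)
  ultimately show ?thesis
    unfolding frame_bounds_def term_eq using sw by blast
qed

text \<open>
  An entry \<open>E n k\<close> can only be nonzero when \<open>m n = m k\<close>, and then \<open>u (m n) = u (m k)\<close> for any
  function \<open>u\<close>. So \<open>E\<close> commutes with the diagonal matrix of the weights \<open>u (m k)\<close> as well.
\<close>
lemma matrix_seq_weighted:
  fixes \<psi> :: "nat \<Rightarrow> 'a::complex_hilbert" and m :: "nat \<Rightarrow> real" and u :: "real \<Rightarrow> real"
  assumes commute: "\<And>n k. complex_of_real (m n) * E n k = E n k * complex_of_real (m k)"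
    and defd: "matrix_seq_defined E \<psi>"
  defines "\<psi>' \<equiv> \<lambda>k. complex_of_real (u (m k)) *\<^sub>C \<psi> k"
  shows "matrix_seq_defined E \<psi>'"
    and "matrix_seq E \<psi>' n = u (m n) *\<^sub>R matrix_seq E \<psi> n"
proof -
  have "E n k = 0 \<or> m n = m k" for n k
    using commute[of n k] by (auto simp: mult.commute)
  then have entry: "E n k * complex_of_real (u (m k)) = complex_of_real (u (m n)) * E n k" for n k
    by (metis mult.commute mult_zero_left)
  have term_eq: "E n k *\<^sub>C \<psi>' k = u (m n) *\<^sub>R (E n k *\<^sub>C \<psi> k)" for n k
    by (simp only: \<psi>'_def scaleC_scaleC entry scaleR_eq_scaleC)
  have sm: "summable (\<lambda>k. E n k *\<^sub>C \<psi> k)" for n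
    using defd by (simp add: matrix_seq_defined_def)
  show "matrix_seq_defined E \<psi>'"
    unfolding matrix_seq_defined_def term_eq using sm by (auto intro: summable_scaleR_right)
  show "matrix_seq E \<psi>' n = u (m n) *\<^sub>R matrix_seq E \<psi> n"
    unfolding matrix_seq_def term_eq by (rule suminf_scaleR_right[OF sm, symmetric])
qed

lemma semi_normalized_bounds:
  assumes "semi_normalized m"
  obtains a b where "0 < a" "\<And>n. a \<le> cmod (m n)" "\<And>n. cmod (m n) \<le> b"
proof
  have bdd: "bdd_below (range (\<lambda>n. cmod (m n)))"
    by (rule bdd_belowI2[of _ 0]) simp
  show "0 < (INF n. cmod (m n))"
    using assms by (simp add: semi_normalized_def)
  show "(INF n. cmod (m n)) \<le> cmod (m n)" for n
    by (rule cINF_lower[OF bdd]) simp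
  show "cmod (m n) \<le> (SUP n. cmod (m n))" for n
    using assms by (intro cSUP_upper) (simp_all add: semi_normalized_def)
qed

text \<open>
  The two signs of the symbol are treated together: a sign \<open>\<epsilon>\<close> that is constant in \<open>n\<close> factors
  out of the series of the multiplier.
\<close>
lemma multiplier_eq_sign_frame_operator:
  fixes \<psi> :: "nat \<Rightarrow> 'a::complex_hilbert" and m :: "nat \<Rightarrow> real"
  assumes semi: "semi_normalized (\<lambda>k. complex_of_real (m k))"
    and commute: "\<And>n k. complex_of_real (m n) * E n k = E n k * complex_of_real (m k)"
    and frame: "E_frame E \<psi>"
    and sign: "\<And>n. m n = \<epsilon> * \<bar>m n\<bar>"
  defines "\<psi>' \<equiv> \<lambda>k. complex_of_real (sqrt \<bar>m k\<bar>) *\<^sub>C \<psi> k"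
  shows "E_frame E \<psi>'"
    and "E_multiplier_defined E (\<lambda>k. complex_of_real (m k)) \<psi> \<psi>"
    and "E_frame_operator_defined E \<psi>'"
    and "E_multiplier E (\<lambda>k. complex_of_real (m k)) \<psi> \<psi> = (\<lambda>f. \<epsilon> *\<^sub>R E_frame_operator E \<psi>' f)"
    and "invertible_operator (E_frame_operator E \<psi>')"
proof -
  define g where "g = matrix_seq E \<psi>"
  define h where "h = (\<lambda>n. sqrt \<bar>m n\<bar> *\<^sub>R g n)"
  obtain A B where g: "frame_bounds A B g" and defd: "matrix_seq_defined E \<psi>"
    using frame by (auto simp: E_frame_iff g_def)
  obtain a b where "0 < a" "\<And>n. a \<le> \<bar>m n\<bar>" "\<And>n. \<bar>m n\<bar> \<le> b"
    using semi_normalized_bounds[OF semi] by auto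
  then have h: "frame_bounds (a * A) (b * B) h"
    unfolding h_def by (intro frame_bounds_weighted[OF g])
  have defd': "matrix_seq_defined E \<psi>'"
    unfolding \<psi>'_def by (rule matrix_seq_weighted(1)[OF commute defd])
  have \<psi>': "matrix_seq E \<psi>' = h"
    unfolding \<psi>'_def h_def g_def by (rule ext) (rule matrix_seq_weighted(2)[OF commute defd])
  have op: "E_frame_operator E \<psi>' = frame_op h"
    by (rule ext) (simp add: E_frame_operator_def frame_op_def \<psi>')
  show "E_frame E \<psi>'"
    using h defd' by (auto simp: E_frame_iff \<psi>')
  show "E_frame_operator_defined E \<psi>'"
    using defd' frame_op_summable[OF h] by (simp add: E_frame_operator_defined_def \<psi>')
  show "invertible_operator (E_frame_operator E \<psi>')"
    unfolding op by (rule invertible_frame_op[OF h])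
  have term_eq: "complex_of_real (m n) *\<^sub>C cinner f (g n) *\<^sub>C g n
      = \<epsilon> *\<^sub>R (cinner f (h n) *\<^sub>C h n)" for f n
  proof -
    have weight: "complex_of_real \<epsilon> * complex_of_real (sqrt \<bar>m n\<bar>) * complex_of_real (sqrt \<bar>m n\<bar>)
        = complex_of_real (m n)"
      by (simp add: mult.assoc flip: of_real_mult sign)
    show ?thesis
      by (simp add: h_def cinner_scaleC_right scaleC_scaleC mult_ac flip: scaleC_of_real weight)
  qed
  show "E_multiplier_defined E (\<lambda>k. complex_of_real (m k)) \<psi> \<psi>"
    unfolding E_multiplier_defined_def g_def[symmetric] term_eq
    using defd frame_op_summable[OF h] by (auto intro: summable_scaleR_right)
  show "E_multiplier E (\<lambda>k. complex_of_real (m k)) \<psi> \<psi> = (\<lambda>f. \<epsilon> *\<^sub>R E_frame_operator E \<psi>' f)"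
    unfolding E_multiplier_def g_def[symmetric] term_eq op frame_op_def
    by (rule ext) (rule suminf_scaleR_right[OF frame_op_summable[OF h], symmetric])
qed

section \<open>Multipliers with a symbol of constant sign\<close>

theorem theorem2p2p8:
  fixes E :: "nat \<Rightarrow> nat \<Rightarrow> complex"
    and m :: "nat \<Rightarrow> real"
    and \<psi> :: "nat \<Rightarrow> 'a::complex_hilbert"
  assumes separable: "separable_space (euclidean :: 'a topology)"
    and invertible: "infinite_matrix_invertible E"
    and semi_normalized: "semi_normalized (\<lambda>k. complex_of_real (m k))"
    and commute: "\<And>n k. complex_of_real (m n) * E n k = E n k * complex_of_real (m k)"
    and frame: "E_frame E \<psi>"
  shows "((\<forall>k. m k > 0) \<longrightarrow>
            E_frame E (\<lambda>k. complex_of_real (sqrt (m k)) *\<^sub>C \<psi> k) \<and>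
            E_multiplier_defined E (\<lambda>k. complex_of_real (m k)) \<psi> \<psi> \<and>
            E_frame_operator_defined E (\<lambda>k. complex_of_real (sqrt (m k)) *\<^sub>C \<psi> k) \<and>
            E_multiplier E (\<lambda>k. complex_of_real (m k)) \<psi> \<psi> =
              E_frame_operator E (\<lambda>k. complex_of_real (sqrt (m k)) *\<^sub>C \<psi> k) \<and>
            invertible_operator (E_multiplier E (\<lambda>k. complex_of_real (m k)) \<psi> \<psi>)) \<and>
         ((\<forall>k. m k < 0) \<longrightarrow>
            E_frame E (\<lambda>k. complex_of_real (sqrt \<bar>m k\<bar>) *\<^sub>C \<psi> k) \<and>
            E_multiplier_defined E (\<lambda>k. complex_of_real (m k)) \<psi> \<psi> \<and>
            E_frame_operator_defined E (\<lambda>k. complex_of_real (sqrt \<bar>m k\<bar>) *\<^sub>C \<psi> k) \<and>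
            E_multiplier E (\<lambda>k. complex_of_real (m k)) \<psi> \<psi> =
              (\<lambda>f. - E_frame_operator E (\<lambda>k. complex_of_real (sqrt \<bar>m k\<bar>) *\<^sub>C \<psi> k) f) \<and>
            invertible_operator (E_multiplier E (\<lambda>k. complex_of_real (m k)) \<psi> \<psi>))"
proof (intro conjI[where P = "_ \<longrightarrow> _"] impI)
  assume pos: "\<forall>k. m k > 0"
  then have abs: "\<bar>m k\<bar> = m k" for k
    by (simp add: less_imp_le)
  then have "m k = 1 * \<bar>m k\<bar>" for k
    by simp
  note * = multiplier_eq_sign_frame_operator[OF semi_normalized commute frame this,
      unfolded abs scaleR_one]
  show "E_frame E (\<lambda>k. complex_of_real (sqrt (m k)) *\<^sub>C \<psi> k) \<and>
      E_multiplier_defined E (\<lambda>k. complex_of_real (m k)) \<psi> \<psi> \<and>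
      E_frame_operator_defined E (\<lambda>k. complex_of_real (sqrt (m k)) *\<^sub>C \<psi> k) \<and>
      E_multiplier E (\<lambda>k. complex_of_real (m k)) \<psi> \<psi> =
        E_frame_operator E (\<lambda>k. complex_of_real (sqrt (m k)) *\<^sub>C \<psi> k) \<and>
      invertible_operator (E_multiplier E (\<lambda>k. complex_of_real (m k)) \<psi> \<psi>)"
    using *(1-3,5) by (simp add: *(4))
next
  assume neg: "\<forall>k. m k < 0"
  then have "m k = - 1 * \<bar>m k\<bar>" for k
    by (simp add: abs_of_neg)
  note * = multiplier_eq_sign_frame_operator[OF semi_normalized commute frame this,
      unfolded scaleR_minus1_left]
  show "E_frame E (\<lambda>k. complex_of_real (sqrt \<bar>m k\<bar>) *\<^sub>C \<psi> k) \<and>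
      E_multiplier_defined E (\<lambda>k. complex_of_real (m k)) \<psi> \<psi> \<and>
      E_frame_operator_defined E (\<lambda>k. complex_of_real (sqrt \<bar>m k\<bar>) *\<^sub>C \<psi> k) \<and>
      E_multiplier E (\<lambda>k. complex_of_real (m k)) \<psi> \<psi> =
        (\<lambda>f. - E_frame_operator E (\<lambda>k. complex_of_real (sqrt \<bar>m k\<bar>) *\<^sub>C \<psi> k) f) \<and>
      invertible_operator (E_multiplier E (\<lambda>k. complex_of_real (m k)) \<psi> \<psi>)"
    using *(1-3) invertible_operator_uminus[OF *(5)] by (simp add: *(4))
qed

end
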